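(* Let $\lambda$ be a PV number with minimal polynomial $\Lambda(z)=z^n+c_{n-1}z^{n-1}+\cdots+c_0$ ($c_j\in\mathbb{Z}$) and conjugates $\lambda=\lambda_1,\lambda_2,\dots,\lambda_n$. Suppose $|c_0|=1$ and let $\sigma\in\mathbb{R}^n_a$ be admissible. Then $$\xi=[\,0,(1-|\lambda_2|)\sigma_2,\dots,(1-|\lambda_n|)\sigma_n\,]^T\in\mathbb{R}^n_a .$$ Moreover, let $m\in\mathbb{N}$, let $a_1,\dots,a_m\in\mathbb{C}\setminus\{0\}$ satisfy $a_1+\cdots+a_m=|\lambda|$, let $\tau_1<\cdots<\tau_m$ be elements of $\mathfrak{L}(\xi)$, and let $f$ be the unique compactly supported distribution on $\mathbb{R}$ satisfying $f(x)=\sum_{j=1}^m a_jf(\lambda x-\tau_j)$ and $\int f(x)\,dx=1$. Then the spaces $$W_k=\operatorname{span}\{\,f(\lambda^kx-\tau):\tau\in\mathfrak{L}(\sigma)\,\},\qquad k\in\mathbb{Z},$$ satisfy $W_k\subset W_{k+1}$ for all $k\in\mathbb{Z}$.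
   Context: A Pisot--Vijayaraghavan (PV) number is a real algebraic integer $\lambda$ with $|\lambda|>1$ whose conjugates $\lambda=\lambda_1,\lambda_2,\dots,\lambda_n$ (the roots of its minimal polynomial) satisfy $|\lambda_j|<1$ for all $j>1$. Let $V$ be the $n\times n$ Vandermonde matrix with entries $V_{i,j}=\lambda_j^{\,i-1}$, so that for $\ell\in\mathbb{Z}^n$ one has $(V^T\ell)_j=\sum_{i=1}^n\ell_i\lambda_j^{\,i-1}$. A vector $\sigma\in\mathbb{R}^n$ is admissible if $\sigma_1=0$, $\sigma_j>0$ for $j\ge2$, and $\sigma_j=\sigma_k$ whenever $2\le j<k\le n$ and $\lambda_j,\lambda_k$ form a nonreal complex conjugate pair. The set of admissible vectors is denoted $\mathbb{R}^n_a$. For $\sigma\in\mathbb{R}^n_a$ the quasilattice corresponding to $\sigma$ is $$\mathfrak{L}(\sigma)=\{(V^T\ell)_1:\ell\in\mathbb{Z}^n,\ |(V^T\ell)_j|<\sigma_j\text{ for all }2\le j\le n\}\subset\mathbb{R}.$$ Here $f(\lambda^kx-\tau)$ denotes the distribution obtained from $f$ by the affine change of variables, span means the set of finite complex linear combinations, and $\subset$ allows equality. The condition $\int f(x)\,dx=1$ means that the Fourier transform of $f$ equals $1$ at $0$. *)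

theory Defs
  imports "HOL-Analysis.Analysis" "Jordan_Normal_Form.Matrix"
begin

unbundle no vec_syntax
  \<comment> \<open>from here on the infix dollar sign and the type \<open>vec\<close> are those of
     \<open>Jordan_Normal_Form\<close>; indices of vectors and matrices start at 0\<close>

section \<open>PV numbers and quasilattices\<close>

definition is_minpoly :: "rat poly \<Rightarrow> real \<Rightarrow> bool" where
  "is_minpoly p x \<longleftrightarrow>
     lead_coeff p = 1 \<and> poly (map_poly of_rat p) x = 0 \<and>
     (\<forall>q. q \<noteq> 0 \<and> poly (map_poly of_rat q) x = 0 \<longrightarrow> degree p \<le> degree q)"

definition conjugates :: "real \<Rightarrow> complex set" where
  "conjugates x = {z. \<exists>p. is_minpoly p x \<and> poly (map_poly of_rat p) z = 0}"

definition pv_number :: "real \<Rightarrow> bool" where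
  "pv_number x \<longleftrightarrow>
     algebraic_int x \<and> \<bar>x\<bar> > 1 \<and> (\<forall>z \<in> conjugates x - {of_real x}. cmod z < 1)"

text \<open>In the following, \<open>lam\<close> is the vector of all conjugates, with the PV number itself
  as component 0.\<close>

definition vandermonde :: "complex vec \<Rightarrow> complex mat" where
  "vandermonde lam = mat (dim_vec lam) (dim_vec lam) (\<lambda>(i, j). (lam $ j) ^ i)"

definition vtrans :: "complex vec \<Rightarrow> int vec \<Rightarrow> complex vec" where
  "vtrans lam l = transpose_mat (vandermonde lam) *\<^sub>v map_vec of_int l"

definition admissible :: "complex vec \<Rightarrow> real vec set" where
  "admissible lam = {\<sigma> \<in> carrier_vec (dim_vec lam).
     \<sigma> $ 0 = 0 \<and>
     (\<forall>j. 1 \<le> j \<and> j < dim_vec lam \<longrightarrow> \<sigma> $ j > 0) \<and>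
     (\<forall>j k. 1 \<le> j \<and> j < k \<and> k < dim_vec lam \<and> lam $ j \<notin> \<real> \<and> lam $ k = cnj (lam $ j)
        \<longrightarrow> \<sigma> $ j = \<sigma> $ k)}"

definition quasilattice :: "complex vec \<Rightarrow> real vec \<Rightarrow> real set" where
  "quasilattice lam \<sigma> = {x. \<exists>l \<in> carrier_vec (dim_vec lam).
     complex_of_real x = vtrans lam l $ 0 \<and>
     (\<forall>j. 1 \<le> j \<and> j < dim_vec lam \<longrightarrow> cmod (vtrans lam l $ j) < \<sigma> $ j)}"


section \<open>Distributions on the real line\<close>

definition iter_deriv :: "nat \<Rightarrow> (real \<Rightarrow> complex) \<Rightarrow> real \<Rightarrow> complex" where
  "iter_deriv k \<phi> = ((\<lambda>g x. vector_derivative g (at x)) ^^ k) \<phi>"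

definition smooth :: "(real \<Rightarrow> complex) \<Rightarrow> bool" where
  "smooth \<phi> \<longleftrightarrow> (\<forall>k x. iter_deriv k \<phi> differentiable (at x))"

definition fun_support :: "(real \<Rightarrow> complex) \<Rightarrow> real set" where
  "fun_support \<phi> = closure {x. \<phi> x \<noteq> 0}"

definition test_functions :: "(real \<Rightarrow> complex) set" where
  "test_functions = {\<phi>. smooth \<phi> \<and> compact (fun_support \<phi>)}"

text \<open>A distribution is a linear functional on the test functions which is continuous, i.e.
  satisfies the usual seminorm estimate on every compact set. As functions are total, we
  require the value 0 outside the test functions; thus HOL equality of two distributions
  is equality as functionals on test functions.\<close>

definition distribution :: "((real \<Rightarrow> complex) \<Rightarrow> complex) \<Rightarrow> bool" where
  "distribution u \<longleftrightarrow>
     (\<forall>\<phi>. \<phi> \<notin> test_functions \<longrightarrow> u \<phi> = 0) \<and>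
     (\<forall>\<phi> \<in> test_functions. \<forall>\<psi> \<in> test_functions. u (\<lambda>x. \<phi> x + \<psi> x) = u \<phi> + u \<psi>) \<and>
     (\<forall>\<phi> \<in> test_functions. \<forall>c. u (\<lambda>x. c * \<phi> x) = c * u \<phi>) \<and>
     (\<forall>K. compact K \<longrightarrow> (\<exists>C N. \<forall>\<phi> \<in> test_functions. fun_support \<phi> \<subseteq> K \<longrightarrow>
        cmod (u \<phi>) \<le> C * (\<Sum>k\<le>N. SUP x. cmod (iter_deriv k \<phi> x))))"

definition distr_support :: "((real \<Rightarrow> complex) \<Rightarrow> complex) \<Rightarrow> real set" where
  "distr_support u =
     - \<Union>{U. open U \<and> (\<forall>\<phi> \<in> test_functions. fun_support \<phi> \<subseteq> U \<longrightarrow> u \<phi> = 0)}"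

definition compactly_supported :: "((real \<Rightarrow> complex) \<Rightarrow> complex) \<Rightarrow> bool" where
  "compactly_supported u \<longleftrightarrow> compact (distr_support u)"

text \<open>\<open>affine_change u a b\<close> is the distribution u(ax - b), for nonzero a: substituting
  y = ax - b in the integral of u(ax - b) \<phi>(x) gives the formula below. An affine map
  with nonzero slope preserves test functions and non-test functions, so the convention
  of the value 0 off the test functions is respected.\<close>

definition affine_change ::
    "((real \<Rightarrow> complex) \<Rightarrow> complex) \<Rightarrow> real \<Rightarrow> real \<Rightarrow> (real \<Rightarrow> complex) \<Rightarrow> complex" where
  "affine_change u a b = (\<lambda>\<phi>. u (\<lambda>y. \<phi> ((y + b) / a)) / of_real \<bar>a\<bar>)"

text \<open>A compactly supported distribution is applied to an arbitrary smooth function by means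
  of a cutoff function; the result does not depend on which cutoff function is chosen.\<close>

definition cutoff_for :: "((real \<Rightarrow> complex) \<Rightarrow> complex) \<Rightarrow> (real \<Rightarrow> complex) \<Rightarrow> bool" where
  "cutoff_for u \<chi> \<longleftrightarrow>
     \<chi> \<in> test_functions \<and> (\<exists>U. open U \<and> distr_support u \<subseteq> U \<and> (\<forall>x\<in>U. \<chi> x = 1))"

definition smooth_pairing ::
    "((real \<Rightarrow> complex) \<Rightarrow> complex) \<Rightarrow> (real \<Rightarrow> complex) \<Rightarrow> complex" where
  "smooth_pairing u \<psi> = u (\<lambda>x. (SOME \<chi>. cutoff_for u \<chi>) x * \<psi> x)"

definition fourier :: "((real \<Rightarrow> complex) \<Rightarrow> complex) \<Rightarrow> real \<Rightarrow> complex" where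
  "fourier u t = smooth_pairing u (\<lambda>x. exp (- (\<i> * of_real t * of_real x)))"

definition complex_span ::
    "((real \<Rightarrow> complex) \<Rightarrow> complex) set \<Rightarrow> ((real \<Rightarrow> complex) \<Rightarrow> complex) set" where
  "complex_span S = {w. \<exists>F c. finite F \<and> F \<subseteq> S \<and> w = (\<lambda>\<phi>. \<Sum>u\<in>F. c u * u \<phi>)}"

definition space_W ::
    "complex vec \<Rightarrow> real \<Rightarrow> real vec \<Rightarrow> ((real \<Rightarrow> complex) \<Rightarrow> complex) \<Rightarrow> int
       \<Rightarrow> ((real \<Rightarrow> complex) \<Rightarrow> complex) set" where
  "space_W lam \<theta> \<sigma> f k =
     complex_span {affine_change f (\<theta> powi k) \<tau> | \<tau>. \<tau> \<in> quasilattice lam \<sigma>}"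

end

theory Submission
  imports Defs
begin

text \<open>Rescaling the refinement equation gives
  \<open>f(\<theta>\<^sup>k x - \<tau>) = \<Sum>\<^sub>j a\<^sub>j f(\<theta>\<^sup>k\<^sup>+\<^sup>1 x - (\<theta>\<tau> + \<tau>\<^sub>j))\<close>, so it suffices that
  \<open>\<theta>\<tau> + \<tau>\<^sub>j\<close> lies in the quasilattice of \<open>\<sigma>\<close>. Multiplication by \<open>\<theta>\<close> acts on integer
  coordinates because the minimal polynomial is monic over the integers, and multiplies the
  \<open>j\<close>-th conjugate coordinate by \<open>\<lambda>\<^sub>j\<close>; the bound
  \<open>\<bar>\<lambda>\<^sub>j\<bar> \<sigma>\<^sub>j + (1 - \<bar>\<lambda>\<^sub>j\<bar>) \<sigma>\<^sub>j = \<sigma>\<^sub>j\<close> then explains the choice of \<open>\<xi>\<close>.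
  That \<open>\<xi>\<close> is positive uses that \<open>\<theta>\<close> is a simple root of its minimal polynomial, so that
  \<open>\<bar>\<lambda>\<^sub>j\<bar> < 1\<close> for every \<open>j\<close> other than 0.\<close>

section \<open>Finite complex linear combinations\<close>

lemma complex_span_zero: "(\<lambda>_. 0) \<in> complex_span S"
  unfolding complex_span_def by (intro CollectI exI[of _ "{}"]) auto

lemma complex_span_base:
  assumes "u \<in> S"
  shows "u \<in> complex_span S"
  unfolding complex_span_def
  using assms by (intro CollectI exI[of _ "{u}"] exI[of _ "\<lambda>_. 1"]) auto

lemma complex_span_scale:
  assumes "u \<in> complex_span S"
  shows "(\<lambda>\<phi>. b * u \<phi>) \<in> complex_span S"
proof -
  obtain F c where F: "finite F" "F \<subseteq> S" "u = (\<lambda>\<phi>. \<Sum>v\<in>F. c v * v \<phi>)"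
    using assms unfolding complex_span_def by blast
  show ?thesis
    unfolding complex_span_def using F
    by (intro CollectI exI[of _ F] exI[of _ "\<lambda>v. b * c v"])
       (auto simp: sum_distrib_left mult.assoc)
qed

lemma complex_span_add:
  assumes "u \<in> complex_span S" "v \<in> complex_span S"
  shows "(\<lambda>\<phi>. u \<phi> + v \<phi>) \<in> complex_span S"
proof -
  obtain F c where F: "finite F" "F \<subseteq> S" "u = (\<lambda>\<phi>. \<Sum>w\<in>F. c w * w \<phi>)"
    using assms(1) unfolding complex_span_def by blast
  obtain G d where G: "finite G" "G \<subseteq> S" "v = (\<lambda>\<phi>. \<Sum>w\<in>G. d w * w \<phi>)"
    using assms(2) unfolding complex_span_def by blast
  \<comment> \<open>\<open>F\<close> and \<open>G\<close> may overlap, so both coefficient functions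
    are extended by 0 to the union and added there.\<close>
  define e where "e w = (if w \<in> F then c w else 0) + (if w \<in> G then d w else 0)" for w
  have "u \<phi> + v \<phi> = (\<Sum>w\<in>F \<union> G. e w * w \<phi>)" for \<phi>
  proof -
    have "u \<phi> = (\<Sum>w\<in>F \<union> G. (if w \<in> F then c w else 0) * w \<phi>)"
      unfolding F(3) using F(1) G(1) by (intro sum.mono_neutral_cong_left) auto
    moreover have "v \<phi> = (\<Sum>w\<in>F \<union> G. (if w \<in> G then d w else 0) * w \<phi>)"
      unfolding G(3) using F(1) G(1) by (intro sum.mono_neutral_cong_left) auto
    ultimately show ?thesis
      by (simp add: e_def distrib_right sum.distrib)
  qed
  then show ?thesis
    unfolding complex_span_def using F(1,2) G(1,2)
    by (intro CollectI exI[of _ "F \<union> G"] exI[of _ e]) auto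
qed

text \<open>Summing over indices lets different indices give the same distribution, which the
  set-based \<open>complex_span\<close> does not allow directly. For infinite \<open>I\<close> the
  sum is 0 by convention.\<close>

lemma complex_span_sum:
  assumes "\<And>i. i \<in> I \<Longrightarrow> u i \<in> complex_span S"
  shows "(\<lambda>\<phi>. \<Sum>i\<in>I. c i * u i \<phi>) \<in> complex_span S"
  using assms
proof (induction I rule: infinite_finite_induct)
  case (insert i I)
  then show ?case
    using complex_span_add[OF complex_span_scale[of "u i" S "c i"]] by simp
qed (auto simp: complex_span_zero)

lemma complex_span_subset:
  assumes "S \<subseteq> complex_span T"
  shows "complex_span S \<subseteq> complex_span T"
proof
  fix w assume "w \<in> complex_span S"
  then obtain F c where F: "F \<subseteq> S" "w = (\<lambda>\<phi>. \<Sum>u\<in>F. c u * u \<phi>)"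
    unfolding complex_span_def by blast
  show "w \<in> complex_span T"
    unfolding F(2) by (rule complex_span_sum) (use F(1) assms in auto)
qed

section \<open>Multiplication by the conjugates in integer coordinates\<close>

lemma vtrans_index:
  assumes "j < dim_vec lam" "l \<in> carrier_vec (dim_vec lam)"
  shows "vtrans lam l $ j = (\<Sum>i<dim_vec lam. of_int (l $ i) * (lam $ j) ^ i)"
  using assms unfolding vtrans_def vandermonde_def
  by (auto simp: scalar_prod_def atLeast0LessThan mult.commute intro!: sum.cong)

lemma vtrans_add:
  assumes "j < dim_vec lam" "l \<in> carrier_vec (dim_vec lam)" "l' \<in> carrier_vec (dim_vec lam)"
  shows "vtrans lam (l + l') $ j = vtrans lam l $ j + vtrans lam l' $ j"
  using assms by (simp add: vtrans_index distrib_right sum.distrib)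

text \<open>Read \<open>l\<close> as the coefficients of a polynomial evaluated at each
  \<open>lam $ j\<close>. Multiplying by the variable and reducing modulo \<open>p\<close> keeps the
  coefficients integral because \<open>p\<close> is monic, and leaves the values at the roots of
  \<open>p\<close> unchanged by the reduction.\<close>

lemma vtrans_companion:
  fixes p :: "int poly"
  assumes monic: "lead_coeff p = 1" and deg: "degree p = dim_vec lam" "dim_vec lam > 0"
    and root: "\<And>j. j < dim_vec lam \<Longrightarrow> poly (map_poly of_int p) (lam $ j) = 0"
    and l: "l \<in> carrier_vec (dim_vec lam)"
  obtains l' where "l' \<in> carrier_vec (dim_vec lam)"
    "\<And>j. j < dim_vec lam \<Longrightarrow> vtrans lam l' $ j = lam $ j * vtrans lam l $ j"
proof -
  obtain m where m: "dim_vec lam = Suc m"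
    using deg(2) by (cases "dim_vec lam") auto
  \<comment> \<open>Shift the coefficients up by one, then subtract \<open>l $ m\<close> times
    \<open>p\<close> to cancel the overflowing power \<open>Suc m\<close>.\<close>
  define l' where "l' = vec (Suc m)
    (\<lambda>i. (if i = 0 then 0 else l $ (i - 1)) - l $ m * coeff p i)"
  have l': "l' \<in> carrier_vec (dim_vec lam)"
    by (simp add: l'_def m)
  have "vtrans lam l' $ j = lam $ j * vtrans lam l $ j" if j: "j < dim_vec lam" for j
  proof -
    define z where "z = lam $ j"
    have "0 = poly (map_poly of_int p) z"
      using root[OF j] by (simp add: z_def)
    also have "\<dots> = (\<Sum>i\<le>Suc m. of_int (coeff p i) * z ^ i)"
      using deg(1) m by (simp add: poly_altdef coeff_map_poly degree_map_poly)
    also have "\<dots> = (\<Sum>i<Suc m. of_int (coeff p i) * z ^ i) + z ^ Suc m"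
      using monic deg(1) m by (simp add: lessThan_Suc_atMost)
    finally have red: "(\<Sum>i<Suc m. of_int (coeff p i) * z ^ i) = - (z ^ Suc m)"
      by (simp add: eq_neg_iff_add_eq_0)
    have "vtrans lam l' $ j = (\<Sum>i<Suc m. of_int (l' $ i) * z ^ i)"
      using vtrans_index[OF j l'] by (simp only: m z_def)
    also have "\<dots> = (\<Sum>i<Suc m. (if i = 0 then 0 else of_int (l $ (i - 1)) * z ^ i)
        - of_int (l $ m) * (of_int (coeff p i) * z ^ i))"
      by (intro sum.cong) (auto simp: l'_def algebra_simps)
    also have "\<dots> = (\<Sum>i<Suc m. if i = 0 then 0 else of_int (l $ (i - 1)) * z ^ i)
        - of_int (l $ m) * (\<Sum>i<Suc m. of_int (coeff p i) * z ^ i)"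
      by (simp only: sum_subtractf sum_distrib_left)
    \<comment> \<open>The term at 0 vanishes and the rest is reindexed; \<open>red\<close> turns the
      subtracted multiple of \<open>p\<close> into the missing top term.\<close>
    also have "\<dots> = (\<Sum>i<m. of_int (l $ i) * z ^ Suc i) + of_int (l $ m) * z ^ Suc m"
      unfolding red by (subst sum.lessThan_Suc_shift) simp
    also have "\<dots> = z * (\<Sum>i<Suc m. of_int (l $ i) * z ^ i)"
      by (simp add: sum_distrib_left algebra_simps)
    also have "\<dots> = lam $ j * vtrans lam l $ j"
      using vtrans_index[OF j l] by (simp only: m z_def)
    finally show ?thesis .
  qed
  with l' show ?thesis by (rule that)
qed

section \<open>Simplicity of the root of a minimal polynomial\<close>

text \<open>The derivative is nonzero of smaller degree, so a common root would contradict
  minimality.\<close>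

lemma is_minpoly_pderiv_nonzero:
  assumes "is_minpoly p x" "degree p > 0"
  shows "poly (map_poly of_rat (pderiv p)) x \<noteq> 0"
proof
  assume "poly (map_poly of_rat (pderiv p)) x = 0"
  moreover have "pderiv p \<noteq> 0"
    using assms(2) by (simp add: pderiv_eq_0_iff)
  ultimately have "degree p \<le> degree (pderiv p)"
    using assms(1) unfolding is_minpoly_def by blast
  then show False
    using assms(2) by (simp add: degree_pderiv)
qed

lemma poly_of_int_poly_of_real:
  fixes p :: "int poly"
  shows "poly (map_poly of_int p) (of_real x :: complex) = of_real (poly (map_poly of_int p) x)"
  by (simp add: poly_altdef coeff_map_poly degree_map_poly)

lemma map_poly_of_rat_of_int:
  "map_poly (of_rat :: rat \<Rightarrow> 'a::field_char_0) (map_poly of_int p) = map_poly of_int p"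
  by (rule poly_eqI) (simp add: coeff_map_poly)

lemma pderiv_of_int_poly:
  "pderiv (map_poly of_int p) = (map_poly of_int (pderiv p) :: 'a::{comm_semiring_1,ring_1,semiring_no_zero_divisors} poly)"
  by (rule poly_eqI) (simp add: coeff_map_poly coeff_pderiv)

text \<open>By the product rule, each summand of the derivative keeps one of the two equal factors.
  This serves to rule out a repetition of the PV number in \<open>lam\<close>.\<close>

lemma pderiv_prod_double_root:
  fixes c :: "nat \<Rightarrow> 'a :: idom"
  assumes "i < n" "j < n" "i \<noteq> j" "c i = c j"
  shows "poly (pderiv (\<Prod>k<n. [:- c k, 1:])) (c i) = 0"
proof -
  have "{..<n} = insert i (insert j ({..<n} - {i, j}))"
    using assms by auto
  then have "(\<Prod>k<n. [:- c k, 1:]) = [:- c i, 1:] * ([:- c j, 1:] * (\<Prod>k\<in>{..<n} - {i, j}. [:- c k, 1:]))"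
    using assms(3) by (metis (no_types, lifting) Diff_iff finite.emptyI finite_Diff finite_insert
        finite_lessThan insertCI insertE prod.insert)
  then show ?thesis
    using assms(4) by (simp only: pderiv_mult poly_add poly_mult) simp
qed

section \<open>Refinement of quasilattices and of distributions\<close>

lemma quasilattice_refine:
  fixes p :: "int poly"
  assumes monic: "lead_coeff p = 1" and deg: "degree p = dim_vec lam" "dim_vec lam > 0"
    and root: "\<And>j. j < dim_vec lam \<Longrightarrow> poly (map_poly of_int p) (lam $ j) = 0"
    and \<theta>: "lam $ 0 = of_real \<theta>"
    and \<xi>: "\<And>j. 1 \<le> j \<Longrightarrow> j < dim_vec lam \<Longrightarrow> \<xi> $ j \<le> (1 - cmod (lam $ j)) * \<sigma> $ j"
    and x: "x \<in> quasilattice lam \<sigma>" and y: "y \<in> quasilattice lam \<xi>"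
  shows "\<theta> * x + y \<in> quasilattice lam \<sigma>"
proof -
  obtain l where l: "l \<in> carrier_vec (dim_vec lam)" "complex_of_real x = vtrans lam l $ 0"
    "\<And>j. 1 \<le> j \<Longrightarrow> j < dim_vec lam \<Longrightarrow> cmod (vtrans lam l $ j) < \<sigma> $ j"
    using x unfolding quasilattice_def by blast
  obtain h where h: "h \<in> carrier_vec (dim_vec lam)" "complex_of_real y = vtrans lam h $ 0"
    "\<And>j. 1 \<le> j \<Longrightarrow> j < dim_vec lam \<Longrightarrow> cmod (vtrans lam h $ j) < \<xi> $ j"
    using y unfolding quasilattice_def by blast
  obtain l' where l': "l' \<in> carrier_vec (dim_vec lam)"
    "\<And>j. j < dim_vec lam \<Longrightarrow> vtrans lam l' $ j = lam $ j * vtrans lam l $ j"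
    using vtrans_companion[OF monic deg root l(1)] by blast
  have sum: "vtrans lam (l' + h) $ j = lam $ j * vtrans lam l $ j + vtrans lam h $ j"
    if "j < dim_vec lam" for j
    using vtrans_add[OF that l'(1) h(1)] l'(2)[OF that] by simp
  have bound: "cmod (vtrans lam (l' + h) $ j) < \<sigma> $ j" if j: "1 \<le> j" "j < dim_vec lam" for j
  proof -
    have "cmod (vtrans lam (l' + h) $ j)
        \<le> cmod (lam $ j) * cmod (vtrans lam l $ j) + cmod (vtrans lam h $ j)"
      unfolding sum[OF j(2)] by (metis norm_mult norm_triangle_ineq)
    \<comment> \<open>Strictness comes from the bound on \<open>h\<close>; the other product is only
      compared weakly, as \<open>lam $ j\<close> may be 0 here.\<close>
    also have "\<dots> < cmod (lam $ j) * \<sigma> $ j + (1 - cmod (lam $ j)) * \<sigma> $ j"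
      using l(3)[OF j] h(3)[OF j] \<xi>[OF j]
      by (intro add_le_less_mono mult_left_mono) auto
    also have "\<dots> = \<sigma> $ j" by (simp add: algebra_simps)
    finally show ?thesis .
  qed
  show ?thesis
    unfolding quasilattice_def
    using l'(1) h(1) bound sum[OF deg(2)] l(2) h(2) \<theta>
    by (intro CollectI bexI[of _ "l' + h"]) auto
qed

text \<open>Substituting \<theta>^k x - t for x uses \<theta>(\<theta>^k x - t) - s = \<theta>^(k+1)
  x - (\<theta>t + s), valid for integers k of either sign since \<theta> is nonzero.\<close>

lemma affine_change_refine:
  assumes "\<theta> \<noteq> 0"
    and refine: "f = (\<lambda>\<phi>. \<Sum>j\<in>J. a j * affine_change f \<theta> (\<tau> j) \<phi>)"
  shows "affine_change f (\<theta> powi k) t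
    = (\<lambda>\<phi>. \<Sum>j\<in>J. a j * affine_change f (\<theta> powi (k + 1)) (\<theta> * t + \<tau> j) \<phi>)"
proof
  fix \<phi> :: "real \<Rightarrow> complex"
  have arg: "((y + s) / \<theta> + t) / \<theta> powi k = (y + (\<theta> * t + s)) / \<theta> powi (k + 1)" for y s
    using assms(1) by (simp add: power_int_add field_simps)
  have abs: "\<bar>\<theta> powi (k + 1)\<bar> = \<bar>\<theta>\<bar> * \<bar>\<theta> powi k\<bar>"
    using assms(1) by (simp add: power_int_add abs_mult)
  have "affine_change f (\<theta> powi k) t \<phi>
      = (\<Sum>j\<in>J. a j * affine_change f \<theta> (\<tau> j) (\<lambda>y. \<phi> ((y + t) / \<theta> powi k)))
        / of_real \<bar>\<theta> powi k\<bar>"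
    \<comment> \<open>\<open>f\<close> occurs on both sides of \<open>refine\<close>, so exactly one
      occurrence is replaced.\<close>
    unfolding affine_change_def[of f "\<theta> powi k"] by (subst refine) (rule refl)
  also have "\<dots> = (\<Sum>j\<in>J. a j * affine_change f (\<theta> powi (k + 1)) (\<theta> * t + \<tau> j) \<phi>)"
    unfolding affine_change_def arg abs by (simp add: sum_divide_distrib)
  finally show "affine_change f (\<theta> powi k) t \<phi>
    = (\<Sum>j\<in>J. a j * affine_change f (\<theta> powi (k + 1)) (\<theta> * t + \<tau> j) \<phi>)" .
qed

theorem theorem3:
  fixes \<theta> :: real and \<Lambda> :: "int poly" and n :: nat
    and lam :: "complex vec" and \<sigma> \<xi> :: "real vec"
  assumes "pv_number \<theta>"
    and "is_minpoly (map_poly of_int \<Lambda>) \<theta>"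
    and "degree \<Lambda> = n"
    and "lam \<in> carrier_vec n"
    and "lam $ 0 = of_real \<theta>"
    and "map_poly of_int \<Lambda> = (\<Prod>j<n. [:- (lam $ j), 1:])"
    and "\<bar>coeff \<Lambda> 0\<bar> = 1"
    and "\<sigma> \<in> admissible lam"
    and "\<xi> = vec n (\<lambda>j. if j = 0 then 0 else (1 - cmod (lam $ j)) * \<sigma> $ j)"
  shows "\<xi> \<in> admissible lam \<and>
    (\<forall>(m::nat) (a :: nat \<Rightarrow> complex) (\<tau> :: nat \<Rightarrow> real) (f :: (real \<Rightarrow> complex) \<Rightarrow> complex).
       (\<forall>j\<in>{1..m}. a j \<noteq> 0) \<and>
       (\<Sum>j=1..m. a j) = of_real \<bar>\<theta>\<bar> \<and>
       strict_mono_on {1..m} \<tau> \<and>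
       (\<forall>j\<in>{1..m}. \<tau> j \<in> quasilattice lam \<xi>) \<and>
       distribution f \<and> compactly_supported f \<and>
       f = (\<lambda>\<phi>. \<Sum>j=1..m. a j * affine_change f \<theta> (\<tau> j) \<phi>) \<and>
       fourier f 0 = 1
       \<longrightarrow> (\<forall>k::int. space_W lam \<theta> \<sigma> f k \<subseteq> space_W lam \<theta> \<sigma> f (k + 1)))"
proof -
  note pv = assms(1) and minpoly = assms(2) and deg = assms(3) and lam = assms(4)
    and lam0 = assms(5) and factors = assms(6) and \<sigma> = assms(8) and \<xi> = assms(9)
  have dim: "dim_vec lam = n" using lam by auto
  have \<theta>: "poly (map_poly of_int \<Lambda>) \<theta> = 0" and monic: "lead_coeff \<Lambda> = 1"
    using minpoly unfolding is_minpoly_def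
    by (simp_all add: map_poly_of_rat_of_int coeff_map_poly degree_map_poly)
  have "n \<noteq> 0"
  proof
    assume "n = 0"
    then have "\<Lambda> = 1"
      using deg monic by (auto elim: degree_eq_zeroE simp: one_pCons)
    then show False using \<theta> by simp
  qed
  then have n: "n > 0" by simp
  have root: "poly (map_poly of_int \<Lambda>) (lam $ j) = 0" if "j < n" for j
    unfolding factors using that by (auto simp: poly_prod)
  \<comment> \<open>\<open>pv_number\<close> bounds the conjugates that differ from \<theta> as
    numbers, so a second occurrence of \<theta> in \<open>lam\<close> must be excluded before the
    bound applies at every index from 1 on.\<close>
  have ne: "lam $ j \<noteq> of_real \<theta>" if "1 \<le> j" "j < n" for j
  proof
    assume "lam $ j = of_real \<theta>"
    then have "poly (pderiv (map_poly of_int \<Lambda>)) (complex_of_real \<theta>) = 0"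
      using pderiv_prod_double_root[of 0 n j "\<lambda>j. lam $ j"] that lam0 unfolding factors by simp
    \<comment> \<open>Factors are complex but minimality is rational; the integer coefficients carry
      the vanishing derivative across.\<close>
    then have "poly (map_poly of_int (pderiv \<Lambda>)) \<theta> = 0"
      by (simp add: pderiv_of_int_poly poly_of_int_poly_of_real)
    moreover have "degree (map_poly of_int \<Lambda> :: rat poly) > 0"
      using n deg by (simp add: degree_map_poly)
    ultimately show False
      using is_minpoly_pderiv_nonzero[OF minpoly]
      by (simp add: pderiv_of_int_poly map_poly_of_rat_of_int)
  qed
  have small: "cmod (lam $ j) < 1" if "1 \<le> j" "j < n" for j
  proof -
    have "lam $ j \<in> conjugates \<theta>"
      unfolding conjugates_def
      by (intro CollectI exI[of _ "map_poly of_int \<Lambda>"] conjI minpoly)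
         (simp only: map_poly_of_rat_of_int root[OF that(2)])
    then show ?thesis
      using pv ne[OF that] unfolding pv_number_def by auto
  qed
  have adm: "\<xi> \<in> admissible lam"
  proof -
    have "\<xi> $ j = \<xi> $ k" if "1 \<le> j" "j < k" "k < n" "lam $ j \<notin> \<real>" "lam $ k = cnj (lam $ j)"
      for j k
    proof -
      have "\<sigma> $ j = \<sigma> $ k"
        using \<sigma> that dim unfolding admissible_def by blast
      \<comment> \<open>Complex conjugates have equal modulus, so the scaling factors agree as
        well.\<close>
      then show ?thesis using that \<xi> by simp
    qed
    moreover have "\<xi> $ j > 0" if "1 \<le> j" "j < n" for j
      using \<sigma> small[OF that] that \<xi> dim unfolding admissible_def by simp
    ultimately show ?thesis
      using \<xi> n dim unfolding admissible_def by simp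
  qed
  have quasi: "\<theta> * x + y \<in> quasilattice lam \<sigma>"
    if "x \<in> quasilattice lam \<sigma>" "y \<in> quasilattice lam \<xi>" for x y
  proof (rule quasilattice_refine[OF monic _ _ _ lam0 _ that])
    show "\<xi> $ j \<le> (1 - cmod (lam $ j)) * \<sigma> $ j" if "1 \<le> j" "j < dim_vec lam" for j
      using that unfolding \<xi> dim by simp
  qed (simp_all add: dim deg n root)
  have mono: "space_W lam \<theta> \<sigma> f k \<subseteq> space_W lam \<theta> \<sigma> f (k + 1)"
    if \<tau>: "\<forall>j\<in>{1..m}. \<tau> j \<in> quasilattice lam \<xi>"
      and f: "f = (\<lambda>\<phi>. \<Sum>j=1..m. a j * affine_change f \<theta> (\<tau> j) \<phi>)"
    for m :: nat and a :: "nat \<Rightarrow> complex" and \<tau> f k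
  proof -
    have "\<theta> \<noteq> 0" using pv unfolding pv_number_def by auto
    show ?thesis
      unfolding space_W_def
    proof (intro complex_span_subset subsetI)
      fix u assume "u \<in> {affine_change f (\<theta> powi k) t |t. t \<in> quasilattice lam \<sigma>}"
      then obtain t where t: "t \<in> quasilattice lam \<sigma>" "u = affine_change f (\<theta> powi k) t"
        by blast
      show "u \<in> complex_span
          {affine_change f (\<theta> powi (k + 1)) t |t. t \<in> quasilattice lam \<sigma>}"
        unfolding t(2)
      \<comment> \<open>Each generator expands into terms one level finer, whose translates
        \<open>quasi\<close> keeps in the same quasilattice.\<close>
      proof (subst affine_change_refine[OF \<open>\<theta> \<noteq> 0\<close> f], rule complex_span_sum)
        fix j assume "j \<in> {1..m}"
        then show "affine_change f (\<theta> powi (k + 1)) (\<theta> * t + \<tau> j) \<in> complex_span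
            {affine_change f (\<theta> powi (k + 1)) t |t. t \<in> quasilattice lam \<sigma>}"
          using \<tau> quasi[OF t(1)] by (intro complex_span_base) blast
      qed
    qed
  qed
  show ?thesis
    by (intro conjI adm allI impI, elim conjE) (rule mono)
qed

end
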